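(* For every $k \in \mathbb{N}$ there exist an integer $m \leq 12k+37$ and a set $S \subseteq \{-,+\}^m$ with $|S| \leq 33k+103$ such that: (i) there exists an oriented line arrangement $\mathcal{L}$ (of $m$ lines) with $S \subseteq \mathcal{D}(\mathcal{L})$; (ii) for every oriented line arrangement $\mathcal{L}$ (of $m$ lines) with $S \subseteq \mathcal{D}(\mathcal{L})$ we have $\mathrm{span}(\mathcal{L}) \geq 2^{2^k}$.
   Context: An orientation of a line $\ell \subset \mathbb{R}^2$ labels one of the two open half-planes forming $\mathbb{R}^2\setminus \ell$ as $\ell^-$ and the other as $\ell^+$. An oriented line arrangement is a tuple $\mathcal{L} = (\ell_1,\dots,\ell_m)$ of distinct lines in $\mathbb{R}^2$, each with an orientation. The sign vector of $p \in \mathbb{R}^2$ with respect to $\mathcal{L}$ is the vector $\sigma(p;\mathcal{L}) \in \{-,0,+\}^m$ whose $i$-th coordinate is $-$, $0$ or $+$ according to whether $p \in \ell_i^-$, $p \in \ell_i$ or $p \in \ell_i^+$. The combinatorial description of $\mathcal{L}$ is $\mathcal{D}(\mathcal{L}) := \{\sigma(p;\mathcal{L}) : p \in \mathbb{R}^2\}$. Let $\mathcal{I}(\mathcal{L})$ be the set of points of $\mathbb{R}^2$ that lie on more than one line of $\mathcal{L}$. The span of $\mathcal{L}$ is \[ \mathrm{span}(\mathcal{L}) := \frac{\max_{p,q \in \mathcal{I}(\mathcal{L})} \|p-q\|}{\min_{p,q\in\mathcal{I}(\mathcal{L}),\, p\neq q} \|p-q\|}, \] where $\|\cdot\|$ is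 the Euclidean norm (defined when $|\mathcal{I}(\mathcal{L})| \geq 2$; the assertion $\mathrm{span}(\mathcal{L}) \ge t$ includes that it is defined). *)

theory Defs
  imports "HOL-Analysis.Analysis"
begin

record oriented_line =
  line_of :: "(real^2) set"
  neg_side :: "(real^2) set"
  pos_side :: "(real^2) set"

text \<open>Replacing \<open>(a, b)\<close> by \<open>(-a, -b)\<close> keeps the line and swaps the two sides, so both
  labellings of the open half-planes are covered.\<close>

definition is_oriented_line :: "oriented_line \<Rightarrow> bool" where
  "is_oriented_line h \<longleftrightarrow>
     (\<exists>a b. a \<noteq> 0 \<and>
        line_of h = {x. a \<bullet> x = b} \<and>
        neg_side h = {x. a \<bullet> x < b} \<and>
        pos_side h = {x. a \<bullet> x > b})"

definition oriented_line_arrangement :: "oriented_line list \<Rightarrow> bool" where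
  "oriented_line_arrangement L \<longleftrightarrow>
     (\<forall>h\<in>set L. is_oriented_line h) \<and> distinct (map line_of L)"

datatype sign = Neg | Zero | Pos

definition sign_wrt :: "real^2 \<Rightarrow> oriented_line \<Rightarrow> sign" where
  "sign_wrt p h =
     (if p \<in> neg_side h then Neg else if p \<in> line_of h then Zero else Pos)"

definition sign_vector :: "real^2 \<Rightarrow> oriented_line list \<Rightarrow> sign list" where
  "sign_vector p L = map (sign_wrt p) L"

definition combinatorial_description :: "oriented_line list \<Rightarrow> sign list set" where
  "combinatorial_description L = range (\<lambda>p. sign_vector p L)"

definition intersection_points :: "oriented_line list \<Rightarrow> (real^2) set" where
  "intersection_points L =
     {p. \<exists>i<length L. \<exists>j<length L. i \<noteq> j \<and> p \<in> line_of (L ! i) \<and> p \<in> line_of (L ! j)}"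

text \<open>Meaningful only if there are at least two intersection points; for an arrangement, there
  are only finitely many (\<open>finite_intersection_points\<close> below), so that \<open>Max\<close> and \<open>Min\<close> are
  taken over finite sets.\<close>

definition arrangement_span :: "oriented_line list \<Rightarrow> real" where
  "arrangement_span L =
     Max {norm (p - q) | p q. p \<in> intersection_points L \<and> q \<in> intersection_points L} /
     Min {norm (p - q) | p q. p \<in> intersection_points L \<and> q \<in> intersection_points L \<and> p \<noteq> q}"

lemma sign_wrt_eq_Pos_iff:
  assumes "is_oriented_line h"
  shows "sign_wrt p h = Pos \<longleftrightarrow> p \<in> pos_side h"
  using assms by (auto simp: is_oriented_line_def sign_wrt_def)

lemma ex_oriented_line_iff:
  "(\<exists>h. is_oriented_line h \<and> line_of h = l) \<longleftrightarrow> affine l \<and> aff_dim l = 1"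
proof
  assume "\<exists>h. is_oriented_line h \<and> line_of h = l"
  then obtain a :: "real^2" and b where "a \<noteq> 0" "l = {x. a \<bullet> x = b}"
    by (auto simp: is_oriented_line_def)
  then show "affine l \<and> aff_dim l = 1"
    by (simp add: affine_hyperplane)
next
  assume l: "affine l \<and> aff_dim l = 1"
  then have "aff_dim l = DIM(real^2) - 1" by simp
  then have "\<exists>a b. a \<noteq> 0 \<and> affine hull l = {x. a \<bullet> x = b}"
    by (rule iffD1[OF aff_dim_eq_hyperplane])
  then obtain a b where a: "a \<noteq> 0" and "affine hull l = {x. a \<bullet> x = b}"
    by blast
  moreover have "affine hull l = l" using l affine_hull_eq by blast
  ultimately have "l = {x. a \<bullet> x = b}" by metis
  with a have "is_oriented_line \<lparr>line_of = l, neg_side = {x. a \<bullet> x < b}, pos_side = {x. a \<bullet> x > b}\<rparr>"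
    unfolding is_oriented_line_def by (intro exI[of _ a] exI[of _ b]) simp
  then show "\<exists>h. is_oriented_line h \<and> line_of h = l"
    by (intro exI conjI) (assumption, simp)
qed

lemma finite_intersection_points:
  assumes "oriented_line_arrangement L"
  shows "finite (intersection_points L)"
proof -
  have line: "affine (line_of (L ! i))" "aff_dim (line_of (L ! i)) = 1" if "i < length L" for i
  proof -
    have "is_oriented_line (L ! i)"
      using assms that by (simp add: oriented_line_arrangement_def)
    then show "affine (line_of (L ! i))" "aff_dim (line_of (L ! i)) = 1"
      using ex_oriented_line_iff by blast+
  qed
  have fin: "finite (line_of (L ! i) \<inter> line_of (L ! j))"
    if ij: "i < length L" "j < length L" "i \<noteq> j" for i j
  proof -
    let ?A = "line_of (L ! i)" and ?B = "line_of (L ! j)"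
    have A: "affine ?A" "aff_dim ?A = 1" and B: "affine ?B" "aff_dim ?B = 1"
      using line ij by blast+
    have "?A \<noteq> ?B"
      using assms ij nth_eq_iff_index_eq[of "map line_of L" i j]
      by (simp add: oriented_line_arrangement_def)
    have AB: "affine (?A \<inter> ?B)" using A B by (simp add: affine_Int)
    have "\<not> ?A \<subseteq> ?B"
    proof
      assume "?A \<subseteq> ?B"
      then have "affine hull ?A \<subset> affine hull ?B"
        using \<open>?A \<noteq> ?B\<close> A(1) B(1) by (metis affine_hull_eq psubsetI)
      then show False using aff_dim_psubset[of ?A ?B] A(2) B(2) by simp
    qed
    then have "affine hull (?A \<inter> ?B) \<subset> affine hull ?A"
      using AB A(1) by (metis affine_hull_eq inf_le1 inf_le2 psubsetI)
    then have "aff_dim (?A \<inter> ?B) < 1" using aff_dim_psubset A(2) by metis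
    then have "aff_dim (?A \<inter> ?B) = -1 \<or> aff_dim (?A \<inter> ?B) = 0"
      using aff_dim_geq[of "?A \<inter> ?B"] by linarith
    then have "?A \<inter> ?B = {} \<or> (\<exists>c. ?A \<inter> ?B = {c})"
      unfolding aff_dim_empty[symmetric] aff_dim_eq_0 .
    then show ?thesis by (metis finite.emptyI finite.insertI)
  qed
  have "intersection_points L \<subseteq>
      (\<Union>(i, j)\<in>{(i, j). i < length L \<and> j < length L \<and> i \<noteq> j}. line_of (L ! i) \<inter> line_of (L ! j))"
    by (auto simp: intersection_points_def)
  moreover have "finite {(i, j). i < length L \<and> j < length L \<and> i \<noteq> j}"
    by (rule finite_subset[of _ "{..<length L} \<times> {..<length L}"]) auto
  then have "finite (\<Union>(i, j)\<in>{(i, j). i < length L \<and> j < length L \<and> i \<noteq> j}.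
      line_of (L ! i) \<inter> line_of (L ! j))"
    by (rule finite_UN_I) (use fin in \<open>simp split: prod.splits\<close>)
  ultimately show ?thesis by (rule finite_subset)
qed

end

theory Submission
  imports Defs
begin

text \<open>
  Lines 0, 1, 2 bound a triangle with affine functionals \<open>f\<^sub>0, f\<^sub>1, f\<^sub>2\<close>; every
  other line is written as \<open>a f\<^sub>0 + b f\<^sub>1 = f\<^sub>2\<close> after rescaling, so it cuts the three sides
  at positions determined by \<open>a\<close>, \<open>b\<close> and \<open>b / a\<close>. By Menelaus the third position is the quotient of
  the other two, so comparing positions on the three sides multiplies inequalities. Two points on
  opposite sides of line \<open>i\<close> that both lie on the negative side of \<open>A\<close> and the positive side of \<open>B\<close>
  force \<open>A\<close> and \<open>B\<close> to meet line \<open>i\<close> in a prescribed order; such order constraints involve no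
  incidences, so they can be imposed by cells alone. Starting from a line 6 with \<open>2 a\<^sub>6 < a\<^sub>3\<close>,
  three further lines and six comparisons replace \<open>a\<close> by some \<open>a'\<close> with \<open>a' a\<^sub>3 < a\<^sup>2\<close>, so the
  ratio \<open>a\<^sub>3 / a\<close> is at least squared in each round. This ratio is a cross ratio of four
  intersection points on line 1, and the span is at least the square root of any such cross ratio.

  The model uses the triangle functionals \<open>f\<^sub>0 = y\<close>, \<open>f\<^sub>1 = x\<close>, \<open>f\<^sub>2 = 1 - x - 2 y\<close>, chosen so that
  the comparisons on line 2, which happen outside the triangle, stay in the affine plane.
\<close>

section \<open>Affine functionals and cells\<close>

definition lin :: "(real^2) \<times> real \<Rightarrow> real^2 \<Rightarrow> real" where
  "lin l p = fst l \<bullet> p - snd l"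

text \<open>A pattern \<open>w\<close> prescribes the side of line \<open>j\<close> by the sign of \<open>w j\<close>; lines with \<open>w j = 0\<close> are
  unconstrained.\<close>

definition sat :: "(nat \<Rightarrow> (real^2) \<times> real) \<Rightarrow> nat \<Rightarrow> (nat \<Rightarrow> real) \<Rightarrow> real^2 \<Rightarrow> bool" where
  "sat h m w p \<longleftrightarrow> (\<forall>j<m. w j \<noteq> 0 \<longrightarrow> w j * lin (h j) p > 0)"

definition to_line :: "(real^2) \<times> real \<Rightarrow> oriented_line" where
  "to_line l = \<lparr>line_of = {x. lin l x = 0}, neg_side = {x. lin l x < 0}, pos_side = {x. lin l x > 0}\<rparr>"

lemma is_oriented_line_to_line: "fst l \<noteq> 0 \<Longrightarrow> is_oriented_line (to_line l)"
  unfolding is_oriented_line_def to_line_def lin_def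
  by (intro exI[of _ "fst l"] exI[of _ "snd l"]) auto

lemma line_of_to_line: "line_of (to_line l) = {x. lin l x = 0}"
  by (simp add: to_line_def)

lemma is_oriented_lineE:
  assumes "is_oriented_line H"
  obtains l where "fst l \<noteq> 0" "H = to_line l"
proof -
  obtain a b where "a \<noteq> 0" "line_of H = {x. a \<bullet> x = b}" "neg_side H = {x. a \<bullet> x < b}"
    "pos_side H = {x. a \<bullet> x > b}"
    using assms unfolding is_oriented_line_def by blast
  then have "fst (a, b) \<noteq> 0" "H = to_line (a, b)"
    by (auto simp: to_line_def lin_def intro!: oriented_line.equality)
  then show thesis by (rule that)
qed

lemma sign_wrt_to_line:
  "sign_wrt p (to_line l) = (if lin l p < 0 then Neg else if lin l p = 0 then Zero else Pos)"
  by (simp add: sign_wrt_def to_line_def)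

lemma lin_convex_comb: "lin l ((1 - t) *\<^sub>R p + t *\<^sub>R q) = (1 - t) * lin l p + t * lin l q"
  by (simp add: lin_def algebra_simps)

lemma lin_closed_segment_zero:
  assumes "r \<in> closed_segment p q" "lin l p = 0" "lin l q = 0"
  shows "lin l r = 0"
  using assms by (auto simp: closed_segment_def lin_convex_comb)

lemma sat_closed_segment:
  assumes "sat h m w p" "sat h m w q" "r \<in> closed_segment p q"
  shows "sat h m w r"
  unfolding sat_def
proof (intro allI impI)
  fix j assume j: "j < m" "w j \<noteq> 0"
  obtain t where t: "0 \<le> t" "t \<le> 1" "r = (1 - t) *\<^sub>R p + t *\<^sub>R q"
    using assms(3) by (auto simp: closed_segment_def)
  have pq: "w j * lin (h j) p > 0" "w j * lin (h j) q > 0"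
    using assms j by (auto simp: sat_def)
  have "w j * lin (h j) r = (1 - t) * (w j * lin (h j) p) + t * (w j * lin (h j) q)"
    unfolding t lin_convex_comb by (simp add: algebra_simps)
  also have "\<dots> > 0"
  proof (cases "t = 0")
    case False
    have "0 \<le> (1 - t) * (w j * lin (h j) p)" by (rule mult_nonneg_nonneg) (use t pq in auto)
    moreover have "0 < t * (w j * lin (h j) q)" by (rule mult_pos_pos) (use t pq False in auto)
    ultimately show ?thesis by linarith
  qed (use pq in simp)
  finally show "w j * lin (h j) r > 0" .
qed

text \<open>Convexity: the segment from \<open>p\<close> to \<open>q\<close> crosses line
  \<open>i\<close>, and every other prescribed sign is constant along it.\<close>

lemma edge_point:
  assumes i: "i < m" and p: "sat h m (w(i := 1)) p" and q: "sat h m (w(i := -1)) q"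
  obtains r where "r \<in> closed_segment p q" "lin (h i) r = 0" "sat h m (w(i := 0)) r"
proof -
  have fp: "lin (h i) p > 0" and fq: "lin (h i) q < 0"
    using i p q by (auto simp: sat_def)
  define t where "t = lin (h i) p / (lin (h i) p - lin (h i) q)"
  define r where "r = (1 - t) *\<^sub>R p + t *\<^sub>R q"
  have t: "0 \<le> t" "t \<le> 1" using fp fq by (auto simp: t_def divide_simps)
  then have seg: "r \<in> closed_segment p q" by (auto simp: r_def closed_segment_def)
  moreover have "lin (h i) r = 0"
    unfolding r_def lin_convex_comb t_def using fp fq by (simp add: field_simps)
  moreover have "sat h m (w(i := 0)) p" "sat h m (w(i := 0)) q"
    using p q by (auto simp: sat_def)
  then have "sat h m (w(i := 0)) r" using seg by (rule sat_closed_segment)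
  ultimately show thesis by (rule that)
qed

text \<open>Two crossings of line \<open>i\<close>, one on each side of line \<open>l\<close>, span
  a segment inside line \<open>i\<close>, which in turn crosses line \<open>l\<close>. In this way
  cells alone enclose a vertex.\<close>

lemma vertex_point:
  assumes il: "i < m" "l < m" "i \<noteq> l"
    and ex: "\<And>s t. s \<in> {1, -1} \<Longrightarrow> t \<in> {1, -1} \<Longrightarrow> \<exists>p. sat h m (w(i := s, l := t)) p"
  obtains v where "lin (h i) v = 0" "lin (h l) v = 0" "sat h m (w(i := 0, l := 0)) v"
proof -
  have edge: "\<exists>r. lin (h i) r = 0 \<and> sat h m (w(i := 0, l := t)) r" if t: "t \<in> {1, -1}" for t
  proof -
    obtain p q where p: "sat h m (w(i := 1, l := t)) p" and q: "sat h m (w(i := -1, l := t)) q"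
      using ex[of 1 t] ex[of "-1" t] t by blast
    have twist: "w(i := s, l := t) = (w(l := t))(i := s)" for s
      using il by (intro fun_upd_twist)
    obtain r where "lin (h i) r = 0" "sat h m ((w(l := t))(i := 0)) r"
      using edge_point[OF il(1) p[unfolded twist] q[unfolded twist]] .
    then show ?thesis unfolding twist by blast
  qed
  obtain r r' where r: "lin (h i) r = 0" "sat h m (w(i := 0, l := 1)) r"
    and r': "lin (h i) r' = 0" "sat h m (w(i := 0, l := -1)) r'"
    using edge[of 1] edge[of "-1"] by auto
  obtain v where "v \<in> closed_segment r r'" "lin (h l) v = 0" "sat h m (w(i := 0, l := 0)) v"
    using edge_point[OF il(2) r(2) r'(2)] .
  then show thesis using that r r' lin_closed_segment_zero by blast
qed

text \<open>An affine functional on the plane is determined by its values at three noncollinear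
  points, and both sides agree at the triangle's vertices \<open>vO\<close>, \<open>vP\<close>,
  \<open>vQ\<close>.\<close>

lemma lin_barycentric:
  assumes O: "lin l0 vO = 0" "lin l1 vO = 0" "lin l2 vO \<noteq> 0"
    and P: "lin l0 vP = 0" "lin l2 vP = 0" "lin l1 vP \<noteq> 0"
    and Q: "lin l1 vQ = 0" "lin l2 vQ = 0" "lin l0 vQ \<noteq> 0"
  shows "lin l p = lin l vQ / lin l0 vQ * lin l0 p + lin l vP / lin l1 vP * lin l1 p
      + lin l vO / lin l2 vO * lin l2 p"
proof -
  define u v where "u = vP - vO" and "v = vQ - vO"
  define al be ga where "al = lin l vQ / lin l0 vQ" and "be = lin l vP / lin l1 vP"
    and "ga = lin l vO / lin l2 vO"
  define c where "c = fst l - al *\<^sub>R fst l0 - be *\<^sub>R fst l1 - ga *\<^sub>R fst l2"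
  define G where "G p = lin l p - al * lin l0 p - be * lin l1 p - ga * lin l2 p" for p
  have G: "G p = c \<bullet> (p - vO) + G vO" for p
    by (simp add: G_def c_def lin_def algebra_simps)
  have zero: "G vO = 0" "G vP = 0" "G vQ = 0"
    using assms by (simp_all add: G_def al_def be_def ga_def)
  have 1: "c $ 1 * u $ 1 + c $ 2 * u $ 2 = 0" "c $ 1 * v $ 1 + c $ 2 * v $ 2 = 0"
    using G[of vP] G[of vQ] zero by (simp_all add: u_def v_def inner_vec_def sum_2)
  have dots: "fst l0 \<bullet> u = 0" "fst l1 \<bullet> u \<noteq> 0" "fst l0 \<bullet> v \<noteq> 0" "fst l1 \<bullet> v = 0"
    using assms by (auto simp: u_def v_def lin_def algebra_simps)
  \<comment> \<open>Multiplicativity of 2x2 determinants. The left side is nonzero, so the edge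
    vectors \<open>u\<close> and \<open>v\<close> are independent.\<close>
  have "(fst l1 \<bullet> u) * (fst l0 \<bullet> v) - (fst l0 \<bullet> u) * (fst l1 \<bullet> v)
      = (fst l1 $ 1 * fst l0 $ 2 - fst l1 $ 2 * fst l0 $ 1) * (u $ 1 * v $ 2 - u $ 2 * v $ 1)"
    by (simp add: inner_vec_def sum_2 algebra_simps)
  then have det: "u $ 1 * v $ 2 - u $ 2 * v $ 1 \<noteq> 0" using dots by auto
  have "c $ 1 * (u $ 1 * v $ 2 - u $ 2 * v $ 1) = 0" "c $ 2 * (u $ 1 * v $ 2 - u $ 2 * v $ 1) = 0"
    using 1 by algebra+
  then have "c = 0" using det by (simp add: vec_eq_iff forall_2)
  then have "G p = 0" using G zero by simp
  then show ?thesis by (simp add: G_def al_def be_def ga_def)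
qed

text \<open>The cell is open and nonempty, while finitely many lines form a null set. The vectors in
  \<open>S\<close> must avoid \<open>Zero\<close> even on lines that a pattern leaves free.\<close>

lemma ex_generic_sat:
  assumes p: "sat h m w p" and h: "\<And>j. j < m \<Longrightarrow> fst (h j) \<noteq> 0"
  shows "\<exists>q. sat h m w q \<and> (\<forall>j<m. lin (h j) q \<noteq> 0)"
proof -
  define U where "U = (\<Inter>j\<in>{j. j < m \<and> w j \<noteq> 0}. {x. w j * lin (h j) x > 0})"
  have "open U" unfolding U_def lin_def
    by (intro open_INT ballI open_Collect_less continuous_intros) simp_all
  moreover have "p \<in> U" using p by (auto simp: U_def sat_def)
  ultimately have "\<not> negligible U" using open_not_negligible by blast
  moreover have "negligible (\<Union>j<m. {x. lin (h j) x = 0})"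
    using h by (intro negligible_Union) (auto simp: lin_def negligible_hyperplane)
  ultimately have "\<not> U \<subseteq> (\<Union>j<m. {x. lin (h j) x = 0})"
    using negligible_subset by blast
  then show ?thesis by (auto simp: U_def sat_def)
qed

text \<open>Separates the two halves of the proof: a model of all patterns supplies
  \<open>S\<close>, and any arrangement containing \<open>S\<close> realizes the patterns again,
  because the sign vector chosen for a pattern refines it.\<close>

lemma ex_sign_vectors:
  fixes h :: "nat \<Rightarrow> (real^2) \<times> real"
  assumes h: "\<And>j. j < m \<Longrightarrow> fst (h j) \<noteq> 0"
    and inj: "\<And>i j. i < j \<Longrightarrow> j < m \<Longrightarrow> {x. lin (h i) x = 0} \<noteq> {x. lin (h j) x = 0}"
    and ex: "\<And>w. w \<in> set W \<Longrightarrow> \<exists>p. sat h m w p"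
  shows "\<exists>S. S \<subseteq> {v. length v = m \<and> set v \<subseteq> {Neg, Pos}} \<and> card S \<le> length W \<and>
    (\<exists>L. oriented_line_arrangement L \<and> length L = m \<and> S \<subseteq> combinatorial_description L) \<and>
    (\<forall>h'. S \<subseteq> combinatorial_description (map (to_line \<circ> h') [0..<m]) \<longrightarrow>
       (\<forall>w\<in>set W. \<exists>p. sat h' m w p))"
proof -
  have "\<exists>q. sat h m w q \<and> (\<forall>j<m. lin (h j) q \<noteq> 0)" if w: "w \<in> set W" for w
  proof -
    obtain p where "sat h m w p" using ex[OF w] by blast
    then show ?thesis by (rule ex_generic_sat[OF _ h])
  qed
  then obtain q
    where q: "\<And>w. w \<in> set W \<Longrightarrow> sat h m w (q w) \<and> (\<forall>j<m. lin (h j) (q w) \<noteq> 0)"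
    by metis
  define L where "L = map (to_line \<circ> h) [0..<m]"
  define S where "S = (\<lambda>w. sign_vector (q w) L) ` set W"
  have "inj_on (\<lambda>j. {x. lin (h j) x = 0}) {..<m}"
    by (rule linorder_inj_onI) (use inj in auto)
  then have "oriented_line_arrangement L"
    using h unfolding oriented_line_arrangement_def L_def
    by (auto simp: is_oriented_line_to_line distinct_map line_of_to_line comp_def lessThan_atLeast0)
  moreover have "length L = m" by (simp add: L_def)
  moreover have "S \<subseteq> combinatorial_description L"
    by (auto simp: S_def combinatorial_description_def)
  moreover have "S \<subseteq> {v. length v = m \<and> set v \<subseteq> {Neg, Pos}}"
    using q by (auto simp: S_def sign_vector_def L_def sign_wrt_to_line)
  moreover have "card S \<le> length W"
    unfolding S_def by (meson List.finite_set card_image_le card_length le_trans)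
  moreover have "\<exists>p. sat h' m w p"
    if S: "S \<subseteq> combinatorial_description (map (to_line \<circ> h') [0..<m])" and w: "w \<in> set W" for h' w
  proof -
    obtain p where p: "sign_vector (q w) L = sign_vector p (map (to_line \<circ> h') [0..<m])"
      using S w by (auto simp: S_def combinatorial_description_def)
    have sgn: "sign_wrt (q w) (to_line (h j)) = sign_wrt p (to_line (h' j))" if "j < m" for j
      using arg_cong[OF p, of "\<lambda>v. v ! j"] that by (simp add: sign_vector_def L_def)
    have "sat h' m w p" unfolding sat_def
    proof (intro allI impI)
      fix j assume j: "j < m" "w j \<noteq> 0"
      then have "w j * lin (h j) (q w) > 0" "lin (h j) (q w) \<noteq> 0"
        using q[OF w] by (auto simp: sat_def)
      then show "w j * lin (h' j) p > 0"
        using sgn[OF j(1)] by (auto simp: sign_wrt_to_line zero_less_mult_iff split: if_splits)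
    qed
    then show ?thesis ..
  qed
  ultimately show ?thesis by blast
qed

section \<open>The prescribed sign patterns\<close>

text \<open>An entry \<open>(i, l, w)\<close> stands for the vertex where lines \<open>i\<close> and \<open>l\<close> meet. It is enclosed by four
  points, one in each quadrant of these two lines, on which the other lines have the signs \<open>w\<close>.
  Every line from 3 on separates the vertex on 0 and 1 from both other vertices, except that 5
  leaves it together with the vertex on 0 and 2, and 4 with the vertex on 1 and 2.\<close>

definition vertex_specs :: "(nat \<times> nat \<times> (nat \<Rightarrow> real)) list" where
  "vertex_specs =
     [(0, 1, \<lambda>j. if j = 2 then 1 else -1),
      (0, 2, \<lambda>j. if j = 5 then -1 else 1),
      (1, 2, \<lambda>j. if j = 4 then -1 else 1)]"

text \<open>With \<open>a\<^sub>4, b\<^sub>5 < 0\<close>, \<open>b\<^sub>4 < b\<^sub>3\<close> and \<open>a\<^sub>5 < a\<^sub>3\<close>, a point of this cell satisfies \<open>b\<^sub>3 f\<^sub>1 > f\<^sub>2\<close>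
  and \<open>a\<^sub>3 f\<^sub>0 > f\<^sub>2\<close> while lying below line 6; this is where the initial factor 2 comes from.\<close>

definition seed :: "nat \<Rightarrow> real" where
  "seed = (\<lambda>_. 0)(0 := 1, 1 := 1, 2 := 1, 4 := 1, 5 := 1, 6 := -1)"

text \<open>An entry \<open>(i, l, t, A, B)\<close> compares \<open>A\<close> and \<open>B\<close> along the part of line \<open>i\<close> on which line \<open>l\<close> has
  sign \<open>t\<close>. It forces \<open>b\<^sub>A < b\<^sub>B\<close> for \<open>i = 0\<close>, \<open>a\<^sub>A < a\<^sub>B\<close> for \<open>i = 1\<close> and
  \<open>b\<^sub>B / a\<^sub>B < b\<^sub>A / a\<^sub>A\<close> for \<open>i = 2\<close>.\<close>

definition step_cmps :: "nat \<Rightarrow> (nat \<times> nat \<times> real \<times> nat \<times> nat) list" where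
  "step_cmps i =
     [(1, 2, 1, 7 + 3 * i, 6 + 3 * i), (0, 2, 1, 3, 7 + 3 * i),
      (1, 2, 1, 8 + 3 * i, 6 + 3 * i), (2, 1, -1, 3, 8 + 3 * i),
      (0, 2, 1, 9 + 3 * i, 8 + 3 * i), (2, 1, -1, 9 + 3 * i, 7 + 3 * i)]"

definition cmps :: "nat \<Rightarrow> (nat \<times> nat \<times> real \<times> nat \<times> nat) list" where
  "cmps n = [(0, 2, 1, 4, 3), (1, 2, 1, 5, 3), (2, 1, -1, 6, 3)] @ concat (map step_cmps [0..<n])"

definition cmp_pattern :: "nat \<Rightarrow> real \<Rightarrow> nat \<Rightarrow> nat \<Rightarrow> nat \<Rightarrow> real" where
  "cmp_pattern l s A B = (\<lambda>_. 0)(l := s, A := -1, B := 1)"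

definition signs :: "real list" where
  "signs = [1, -1]"

definition patterns :: "nat \<Rightarrow> (nat \<Rightarrow> real) list" where
  "patterns n = seed #
     map (\<lambda>((i, l, w), s, t). w(i := s, l := t))
       (List.product vertex_specs (List.product signs signs)) @
     map (\<lambda>((i, l, t, A, B), s). (cmp_pattern l t A B)(i := s)) (List.product (cmps n) signs)"

lemma length_patterns: "length (patterns n) = 12 * n + 19"
  by (simp add: patterns_def cmps_def step_cmps_def vertex_specs_def signs_def length_concat comp_def
      sum_list_triv)

lemma set_signs: "set signs = {1, -1}"
  by (simp add: signs_def)

lemma vertex_pattern_in_patterns:
  assumes "(i, l, w) \<in> set vertex_specs" "s \<in> {1, -1}" "t \<in> {1, -1}"
  shows "w(i := s, l := t) \<in> set (patterns n)"
proof -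
  have "((i, l, w), s, t) \<in> set (List.product vertex_specs (List.product signs signs))"
    using assms by (auto simp: set_signs)
  from imageI[OF this, of "\<lambda>((i, l, w), s, t). w(i := s, l := t)"] show ?thesis
    by (simp add: patterns_def)
qed

lemma cmp_pattern_in_patterns:
  assumes "(i, l, t, A, B) \<in> set (cmps n)" "s \<in> {1, -1}"
  shows "(cmp_pattern l t A B)(i := s) \<in> set (patterns n)"
proof -
  have "((i, l, t, A, B), s) \<in> set (List.product (cmps n) signs)"
    using assms by (auto simp: set_signs)
  from imageI[OF this, of "\<lambda>((i, l, t, A, B), s). (cmp_pattern l t A B)(i := s)"] show ?thesis
    by (simp add: patterns_def)
qed

lemma patterns_cases:
  assumes "w \<in> set (patterns n)"
  obtains "w = seed"
    | i l w' s t where "w = w'(i := s, l := t)" "(i, l, w') \<in> set vertex_specs" "s \<in> {1, -1}" "t \<in> {1, -1}"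
    | i l t A B s where "w = (cmp_pattern l t A B)(i := s)" "(i, l, t, A, B) \<in> set (cmps n)" "s \<in> {1, -1}"
  using assms unfolding patterns_def set_signs[symmetric] by auto

section \<open>Doubly exponential cross ratio forced by the patterns\<close>

lemma forced_cross_ratio:
  assumes ex: "\<And>w. w \<in> set (patterns n) \<Longrightarrow> \<exists>p. sat h (7 + 3 * n) w p"
  obtains vO vQ where "lin (h 0) vO = 0" "lin (h 1) vO = 0" "lin (h 1) vQ = 0" "lin (h 2) vQ = 0"
    "lin (h 3) vO < 0" "lin (h 3) vQ > 0" "lin (h (6 + 3 * n)) vO < 0" "lin (h (6 + 3 * n)) vQ > 0"
    "2 ^ 2 ^ n * (lin (h 3) vO / lin (h 3) vQ) \<ge> lin (h (6 + 3 * n)) vO / lin (h (6 + 3 * n)) vQ"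
proof -
  define m where "m = 7 + 3 * n"
  note ex = ex[folded m_def]
  have m: "m \<ge> 7" by (simp add: m_def)
  have vertex: thesis
    if "(i, l, w) \<in> set vertex_specs"
      "\<And>v. lin (h i) v = 0 \<Longrightarrow> lin (h l) v = 0 \<Longrightarrow> sat h m (w(i := 0, l := 0)) v \<Longrightarrow> thesis"
    for i l w thesis
  proof (rule vertex_point[of i m l h w])
    show "i < m" "l < m" "i \<noteq> l" using m that(1) by (auto simp: vertex_specs_def)
    show "\<exists>p. sat h m (w(i := s, l := t)) p" if "s \<in> {1, -1}" "t \<in> {1, -1}" for s t
      by (rule ex[OF vertex_pattern_in_patterns]) (fact \<open>(i, l, w) \<in> set vertex_specs\<close> that)+
  qed (use that in blast)
  obtain vO where O: "lin (h 0) vO = 0" "lin (h 1) vO = 0"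
    and satO: "sat h m ((\<lambda>j. if j = 2 then 1 else -1)(0 := 0, 1 := 0)) vO"
    by (rule vertex[of 0 1 "\<lambda>j. if j = 2 then 1 else -1"]) (simp add: vertex_specs_def)
  obtain vP where P: "lin (h 0) vP = 0" "lin (h 2) vP = 0"
    and satP: "sat h m ((\<lambda>j. if j = 5 then -1 else 1)(0 := 0, 2 := 0)) vP"
    by (rule vertex[of 0 2 "\<lambda>j. if j = 5 then -1 else 1"]) (simp add: vertex_specs_def)
  obtain vQ where Q: "lin (h 1) vQ = 0" "lin (h 2) vQ = 0"
    and satQ: "sat h m ((\<lambda>j. if j = 4 then -1 else 1)(1 := 0, 2 := 0)) vQ"
    by (rule vertex[of 1 2 "\<lambda>j. if j = 4 then -1 else 1"]) (simp add: vertex_specs_def)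
  have O': "lin (h 2) vO > 0" "\<And>j. 3 \<le> j \<Longrightarrow> j < m \<Longrightarrow> lin (h j) vO < 0"
    using satO[unfolded sat_def, rule_format, of 2] satO[unfolded sat_def, rule_format] m by force+
  have P': "lin (h 1) vP > 0" "\<And>j. 3 \<le> j \<Longrightarrow> j < m \<Longrightarrow> j \<noteq> 5 \<Longrightarrow> lin (h j) vP > 0" "lin (h 5) vP < 0"
    using satP[unfolded sat_def, rule_format, of 1] satP[unfolded sat_def, rule_format, of 5]
      satP[unfolded sat_def, rule_format] m by force+
  have Q': "lin (h 0) vQ > 0" "\<And>j. 3 \<le> j \<Longrightarrow> j < m \<Longrightarrow> j \<noteq> 4 \<Longrightarrow> lin (h j) vQ > 0" "lin (h 4) vQ < 0"
    using satQ[unfolded sat_def, rule_format, of 0] satQ[unfolded sat_def, rule_format, of 4]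
      satQ[unfolded sat_def, rule_format] m by force+
  define f0 f1 f2 where "f0 = lin (h 0)" and "f1 = lin (h 1)" and "f2 = lin (h 2)"
  define c where "c j = - lin (h j) vO / f2 vO" for j
  define a where "a j = lin (h j) vQ / f0 vQ / c j" for j
  define b where "b j = lin (h j) vP / f1 vP / c j" for j
  have c: "c j > 0" if "3 \<le> j" "j < m" for j
    using O'(1) O'(2)[OF that] by (simp add: c_def f2_def divide_neg_pos)
  have a: "a j > 0" if "3 \<le> j" "j < m" "j \<noteq> 4" for j
    using Q'(1) Q'(2)[OF that] c[OF that(1,2)] by (simp add: a_def f0_def)
  have a4: "a 4 < 0"
    using Q'(1,3) c[of 4] m by (simp add: a_def f0_def divide_neg_pos)
  have b: "b j > 0" if "3 \<le> j" "j < m" "j \<noteq> 5" for j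
    using P'(1) P'(2)[OF that] c[OF that(1,2)] by (simp add: b_def f1_def)
  have b5: "b 5 < 0"
    using P'(1,3) c[of 5] m by (simp add: b_def f1_def divide_neg_pos)
  have lin: "lin (h j) p = c j * (a j * f0 p + b j * f1 p - f2 p)" if "3 \<le> j" "j < m" for j p
  proof -
    have "lin (h j) p = lin (h j) vQ / lin (h 0) vQ * lin (h 0) p
        + lin (h j) vP / lin (h 1) vP * lin (h 1) p + lin (h j) vO / lin (h 2) vO * lin (h 2) p"
      by (rule lin_barycentric) (use O P Q O'(1) P'(1) Q'(1) in auto)
    moreover have "lin (h j) vQ / lin (h 0) vQ = c j * a j" "lin (h j) vP / lin (h 1) vP = c j * b j"
      "lin (h j) vO / lin (h 2) vO = - c j"
      using c[OF that] by (simp_all add: a_def b_def f0_def f1_def) (simp add: c_def f2_def)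
    ultimately have "lin (h j) p = c j * a j * f0 p + c j * b j * f1 p + - c j * f2 p"
      unfolding f0_def f1_def f2_def by (simp only:)
    then show ?thesis by (simp add: algebra_simps)
  qed
  have pos: "lin (h j) p > 0 \<longleftrightarrow> f2 p < a j * f0 p + b j * f1 p"
    and neg: "lin (h j) p < 0 \<longleftrightarrow> a j * f0 p + b j * f1 p < f2 p" if "3 \<le> j" "j < m" for j p
    using c[OF that] by (simp_all add: lin[OF that] zero_less_mult_iff mult_less_0_iff)
  have cmp: "\<exists>r. lin (h i) r = 0 \<and> t * lin (h l) r > 0 \<and> lin (h A) r < 0 \<and> lin (h B) r > 0"
    if mem: "(i, l, t, A, B) \<in> set (cmps n)" for i l t A B
  proof -
    have mem': "i < 3" "l < 3" "t \<noteq> 0" "i \<noteq> l" "3 \<le> A" "3 \<le> B" "A < m" "B < m" "A \<noteq> B"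
      using mem by (auto simp: cmps_def step_cmps_def m_def)
    obtain p q where "sat h m ((cmp_pattern l t A B)(i := 1)) p"
      "sat h m ((cmp_pattern l t A B)(i := -1)) q"
      using ex[OF cmp_pattern_in_patterns[OF mem]] by blast
    then obtain r where r: "lin (h i) r = 0" "sat h m ((cmp_pattern l t A B)(i := 0)) r"
      using edge_point[of i m] mem' m by (metis less_le_trans le_numeral_extra(4) less_trans not_less)
    then have "t * lin (h l) r > 0" "- 1 * lin (h A) r > 0" "lin (h B) r > 0"
      using r(2)[unfolded sat_def, rule_format, of l] r(2)[unfolded sat_def, rule_format, of A]
        r(2)[unfolded sat_def, rule_format, of B] mem' m
      by (auto simp: cmp_pattern_def)
    then show ?thesis using r(1) by auto
  qed
  have bounds: "3 \<le> A \<and> A < m \<and> 3 \<le> B \<and> B < m" if "(i, l, t, A, B) \<in> set (cmps n)" for i l t A B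
    using that by (auto simp: cmps_def step_cmps_def m_def)
  have cmp0: "b A < b B" if mem: "(0, 2, 1, A, B) \<in> set (cmps n)" and "B \<noteq> 5" for A B
  proof -
    obtain r where r: "f0 r = 0" "f2 r > 0" "lin (h A) r < 0" "lin (h B) r > 0"
      using cmp[OF mem] by (auto simp: f0_def f2_def)
    then have *: "b A * f1 r < f2 r" "f2 r < b B * f1 r"
      using pos[of B] neg[of A] bounds[OF mem] by auto
    then have "f1 r > 0" using b[of B] bounds[OF mem] r(2) \<open>B \<noteq> 5\<close>
      by (metis less_trans zero_less_mult_pos)
    then show ?thesis using * by (meson less_trans mult_less_cancel_right_pos)
  qed
  have cmp1: "a A < a B" if mem: "(1, 2, 1, A, B) \<in> set (cmps n)" and "B \<noteq> 4" for A B
  proof -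
    obtain r where r: "f1 r = 0" "f2 r > 0" "lin (h A) r < 0" "lin (h B) r > 0"
      using cmp[OF mem] by (auto simp: f1_def f2_def)
    then have *: "a A * f0 r < f2 r" "f2 r < a B * f0 r"
      using pos[of B] neg[of A] bounds[OF mem] by auto
    then have "f0 r > 0" using a[of B] bounds[OF mem] r(2) \<open>B \<noteq> 4\<close>
      by (metis less_trans zero_less_mult_pos)
    then show ?thesis using * by (meson less_trans mult_less_cancel_right_pos)
  qed
  have cmp2: "b B * a A < b A * a B"
    if mem: "(2, 1, -1, A, B) \<in> set (cmps n)" and AB: "A \<noteq> 4" "B \<noteq> 4" for A B
  proof -
    obtain r where r: "f2 r = 0" "f1 r < 0" "lin (h A) r < 0" "lin (h B) r > 0"
      using cmp[OF mem] by (auto simp: f1_def f2_def)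
    then have *: "a A * f0 r < b A * (- f1 r)" "b B * (- f1 r) < a B * f0 r"
      using pos[of B r] neg[of A r] bounds[OF mem] by auto
    have "a A > 0" "a B > 0" using a bounds[OF mem] AB by auto
    \<comment> \<open>The position \<open>f0 r / (- f1 r)\<close> lies strictly between
      \<open>b B / a B\<close> and \<open>b A / a A\<close>; multiplying out avoids the
      quotients.\<close>
    then have "a A * (b B * (- f1 r)) < a A * (a B * f0 r)" "a B * (a A * f0 r) < a B * (b A * (- f1 r))"
      using * by (simp_all only: mult_less_cancel_left_pos)
    then have "(b B * a A) * (- f1 r) < (b A * a B) * (- f1 r)" by (simp add: algebra_simps)
    then show ?thesis using r(2) by (meson mult_less_cancel_right_pos neg_0_less_iff_less)
  qed
  have base: "2 * a 6 < a 3"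
  proof -
    obtain p where p: "sat h m seed p" using ex[of seed] by (auto simp: patterns_def)
    have "f0 p > 0" "f1 p > 0" "f2 p > 0" "lin (h 4) p > 0" "lin (h 5) p > 0" "lin (h 6) p < 0"
      using p[unfolded sat_def, rule_format, of 0] p[unfolded sat_def, rule_format, of 1]
        p[unfolded sat_def, rule_format, of 2] p[unfolded sat_def, rule_format, of 4]
        p[unfolded sat_def, rule_format, of 5] p[unfolded sat_def, rule_format, of 6] m
      by (simp_all add: seed_def f0_def f1_def f2_def)
    then have p: "f0 p > 0" "f1 p > 0" "f2 p > 0" "f2 p < a 4 * f0 p + b 4 * f1 p"
      "f2 p < a 5 * f0 p + b 5 * f1 p" "a 6 * f0 p + b 6 * f1 p < f2 p"
      using pos[of 4] pos[of 5] neg[of 6] m by auto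
    have "a 4 * f0 p < 0" "b 5 * f1 p < 0" using a4 b5 p by (simp_all add: mult_neg_pos)
    moreover have "b 4 < b 3" "a 5 < a 3" "b 3 * a 6 < b 6 * a 3"
      using cmp0[of 4 3] cmp1[of 5 3] cmp2[of 6 3] by (auto simp: cmps_def)
    moreover from this have "b 4 * f1 p < b 3 * f1 p" "a 5 * f0 p < a 3 * f0 p" using p by simp_all
    ultimately have lt: "f2 p < b 3 * f1 p" "f2 p < a 3 * f0 p" using p by linarith+
    have ab: "a 3 > 0" "a 6 > 0" "b 3 > 0" "b 6 > 0" using a b m by auto
    \<comment> \<open>Each of \<open>a 6 * f0 p\<close> and \<open>b 6 * f1 p\<close>, multiplied by
      \<open>a 3\<close>, exceeds \<open>a 6 * f2 p\<close>, while their sum stays below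
      \<open>a 3 * f2 p\<close>.\<close>
    have "a 6 * f2 p < a 6 * (b 3 * f1 p)" using ab lt by simp
    also have "\<dots> = (b 3 * a 6) * f1 p" by simp
    also have "\<dots> < (b 6 * a 3) * f1 p"
      by (rule mult_strict_right_mono) (fact \<open>b 3 * a 6 < b 6 * a 3\<close> p)+
    finally have 1: "a 6 * f2 p < a 3 * (b 6 * f1 p)" by (simp add: algebra_simps)
    have 2: "a 6 * f2 p < a 3 * (a 6 * f0 p)"
      using mult_strict_left_mono[OF lt(2) ab(2)] by (simp add: algebra_simps)
    have "a 3 * (a 6 * f0 p + b 6 * f1 p) < a 3 * f2 p" using p ab by simp
    then have "2 * a 6 * f2 p < a 3 * f2 p" using 1 2 by (simp add: algebra_simps)
    then show ?thesis using p by simp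
  qed
  have step: "a (9 + 3 * i) * a 3 < (a (6 + 3 * i))\<^sup>2" if "i < n" for i
  proof -
    have mem: "x \<in> set (cmps n)" if "x \<in> set (step_cmps i)" for x
      using that \<open>i < n\<close> by (auto simp: cmps_def)
    let ?p = "6 + 3 * i" and ?A = "7 + 3 * i" and ?B = "8 + 3 * i" and ?C = "9 + 3 * i"
    have lt: "a ?A < a ?p" "b 3 < b ?A" "a ?B < a ?p" "b ?B * a 3 < b 3 * a ?B"
      "b ?C < b ?B" "b ?A * a ?C < b ?C * a ?A"
      by ((rule cmp0 cmp1 cmp2, rule mem; simp add: step_cmps_def), simp?)+
    have pos: "a 3 > 0" "a ?A > 0" "a ?B > 0" "a ?C > 0" "a ?p > 0" "b 3 > 0" "b ?A > 0" "b ?B > 0"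
      by (rule a b; use \<open>i < n\<close> in \<open>simp add: m_def\<close>)+
    have "b 3 * (a ?C * a 3) < b ?A * (a ?C * a 3)"
      by (rule mult_strict_right_mono) (use lt pos in simp_all)
    also have "\<dots> = (b ?A * a ?C) * a 3" by simp
    also have "\<dots> < (b ?C * a ?A) * a 3" by (rule mult_strict_right_mono) (fact lt pos)+
    also have "\<dots> < (b ?B * a ?A) * a 3" using lt(5) pos by simp
    also have "\<dots> = (b ?B * a 3) * a ?A" by simp
    also have "\<dots> < (b 3 * a ?B) * a ?A" by (rule mult_strict_right_mono) (fact lt pos)+
    also have "\<dots> = b 3 * (a ?B * a ?A)" by simp
    also have "\<dots> < b 3 * (a ?p * a ?p)"
      using mult_strict_mono[OF lt(3) lt(1)] pos by simp
    finally show ?thesis using pos by (simp add: power2_eq_square)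
  qed
  have main: "2 ^ 2 ^ i * a (6 + 3 * i) \<le> a 3" if "i \<le> n" for i
    using that
  proof (induction i)
    case 0
    then show ?case using base by simp
  next
    case (Suc i)
    have pos: "a 3 > 0" "a (6 + 3 * i) > 0" using a Suc.prems by (auto simp: m_def)
    have "(2 ^ 2 ^ Suc i * a (6 + 3 * Suc i)) * a 3 = (2 ^ 2 ^ i)\<^sup>2 * (a (9 + 3 * i) * a 3)"
      by (simp add: power_mult[symmetric] mult.commute)
    also have "\<dots> \<le> (2 ^ 2 ^ i)\<^sup>2 * (a (6 + 3 * i))\<^sup>2"
      using step[of i] Suc.prems by (intro mult_left_mono) auto
    also have "\<dots> = (2 ^ 2 ^ i * a (6 + 3 * i))\<^sup>2" by (simp add: power_mult_distrib)
    also have "\<dots> \<le> (a 3)\<^sup>2" using Suc pos by (intro power_mono) auto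
    finally show ?case using pos by (simp add: power2_eq_square)
  qed
  \<comment> \<open>The factor \<open>f2 vO / f0 vQ\<close> is common to all lines, so only the
    ratio of the \<open>a\<close> values survives.\<close>
  have quot: "lin (h j) vO / lin (h j) vQ = - (f2 vO / f0 vQ) / a j" if "3 \<le> j" "j < m" "j \<noteq> 4" for j
    using c[OF that(1,2)] a[OF that] O'(1) Q'(1) Q'(2)[OF that] O'(2)[OF that(1,2)]
    by (simp add: a_def c_def f0_def f2_def field_simps)
  show thesis
  proof (rule that[of vO vQ])
    have *: "3 \<le> 6 + 3 * n" "6 + 3 * n < m" "6 + 3 * n \<noteq> 4" "3 < m" by (simp_all add: m_def)
    then show "lin (h (6 + 3 * n)) vO < 0" "lin (h (6 + 3 * n)) vQ > 0"
      using O' Q' by blast+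
    have pos: "a 3 > 0" "a (6 + 3 * n) > 0" "f2 vO / f0 vQ > 0"
      using a * O' Q' by (auto simp: f0_def f2_def)
    then have "2 ^ 2 ^ n / a 3 \<le> 1 / a (6 + 3 * n)"
      using main[of n] by (simp add: field_simps)
    then have "(f2 vO / f0 vQ) * (2 ^ 2 ^ n / a 3) \<le> (f2 vO / f0 vQ) * (1 / a (6 + 3 * n))"
      using pos(3) by (intro mult_left_mono) auto
    then show "2 ^ 2 ^ n * (lin (h 3) vO / lin (h 3) vQ)
        \<ge> lin (h (6 + 3 * n)) vO / lin (h (6 + 3 * n)) vQ"
      using quot[of 3] quot[of "6 + 3 * n"] * by (simp add: algebra_simps)
  qed (use O Q O' Q' m in auto)
qed

section \<open>From the cross ratio to the span\<close>

text \<open>Two distances in the numerator and two in the denominator bound such a ratio by the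
  square of the span, hence the square on \<open>R\<close>.\<close>

lemma arrangement_span_ge:
  assumes L: "oriented_line_arrangement L"
    and I: "p \<in> intersection_points L" "q \<in> intersection_points L"
      "p' \<in> intersection_points L" "q' \<in> intersection_points L"
    and ne: "p \<noteq> p'" "q \<noteq> q'"
    and R: "R \<ge> 0" "R\<^sup>2 * (norm (p - p') * norm (q - q')) \<le> norm (p - q') * norm (p' - q)"
  shows "arrangement_span L \<ge> R"
proof -
  let ?I = "intersection_points L"
  define X where "X = {norm (p - q) | p q. p \<in> ?I \<and> q \<in> ?I}"
  define N where "N = {norm (p - q) | p q. p \<in> ?I \<and> q \<in> ?I \<and> p \<noteq> q}"
  have "X = (\<lambda>(p, q). norm (p - q)) ` (?I \<times> ?I)" by (auto simp: X_def)
  then have fX: "finite X" using finite_intersection_points[OF L] by simp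
  have "N \<subseteq> X" by (auto simp: X_def N_def)
  then have fN: "finite N" using fX by (rule finite_subset)
  have N: "norm (p - p') \<in> N" "norm (q - q') \<in> N" using I ne by (auto simp: N_def)
  then have "Min N \<in> N" using fN Min_in by blast
  then have pos: "Min N > 0" by (auto simp: N_def)
  have X: "norm (p - q') \<in> X" "norm (p' - q) \<in> X" using I by (auto simp: X_def)
  have Mx: "norm (p - q') \<le> Max X" "norm (p' - q) \<le> Max X" using X fX by simp_all
  have "(R * Min N)\<^sup>2 = R\<^sup>2 * (Min N * Min N)" by (simp add: power2_eq_square)
  also have "\<dots> \<le> R\<^sup>2 * (norm (p - p') * norm (q - q'))"
    using N fN pos by (intro mult_left_mono mult_mono) auto
  also have "\<dots> \<le> norm (p - q') * norm (p' - q)" by (rule R(2))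
  also have "\<dots> \<le> Max X * Max X" by (rule mult_mono') (use Mx in simp_all)
  finally have "(R * Min N)\<^sup>2 \<le> (Max X)\<^sup>2" by (simp add: power2_eq_square)
  moreover have "Max X \<ge> 0" using Mx(1) norm_ge_zero order_trans by blast
  ultimately have "R * Min N \<le> Max X" by (rule power2_le_imp_le)
  then show ?thesis
    using pos by (simp add: arrangement_span_def X_def[symmetric] N_def[symmetric] field_simps)
qed

lemma arrangement_span_ge_cross_ratio:
  assumes L: "oriented_line_arrangement (map (to_line \<circ> h) [0..<m])"
    and m: "7 \<le> m" "3 \<le> j" "j < m"
    and zero: "lin (h 0) vO = 0" "lin (h 1) vO = 0" "lin (h 1) vQ = 0" "lin (h 2) vQ = 0"
    and sgn: "lin (h 3) vO < 0" "lin (h 3) vQ > 0" "lin (h j) vO < 0" "lin (h j) vQ > 0"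
    and R: "R \<ge> 0" "R\<^sup>2 * (lin (h 3) vO / lin (h 3) vQ) \<ge> lin (h j) vO / lin (h j) vQ"
  shows "card (intersection_points (map (to_line \<circ> h) [0..<m])) \<ge> 2"
    "arrangement_span (map (to_line \<circ> h) [0..<m]) \<ge> R"
proof -
  let ?I = "intersection_points (map (to_line \<circ> h) [0..<m])"
  have I: "v \<in> ?I" if "i < m" "l < m" "i \<noteq> l" "lin (h i) v = 0" "lin (h l) v = 0" for v i l
  proof -
    have "v \<in> line_of (map (to_line \<circ> h) [0..<m] ! i)" "v \<in> line_of (map (to_line \<circ> h) [0..<m] ! l)"
      using that by (simp_all add: line_of_to_line)
    moreover have "i < length (map (to_line \<circ> h) [0..<m])" "l < length (map (to_line \<circ> h) [0..<m])"
      using that by simp_all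
    ultimately show ?thesis using \<open>i \<noteq> l\<close> unfolding intersection_points_def by blast
  qed
  have O: "vO \<in> ?I" and Q: "vQ \<in> ?I" using I[of 0 1] I[of 1 2] zero m by auto
  have ne: "vO \<noteq> vQ" using sgn by auto
  then have "card {vO, vQ} = 2" by simp
  then show "card ?I \<ge> 2"
    using card_mono[OF finite_intersection_points[OF L], of "{vO, vQ}"] O Q by simp
  define t where "t i = - lin (h i) vO / (lin (h i) vQ - lin (h i) vO)" for i
  define y where "y i = (1 - t i) *\<^sub>R vO + t i *\<^sub>R vQ" for i
  have y0: "lin (h i) (y i) = 0" if "lin (h i) vO < 0" "lin (h i) vQ > 0" for i
    using that unfolding y_def lin_convex_comb t_def by (simp add: field_simps)
  have y1: "lin (h 1) (y i) = 0" for i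
    unfolding y_def lin_convex_comb using zero by simp
  have Y: "y 3 \<in> ?I" "y j \<in> ?I" using I[of 3 1] I[of j 1] y0 y1 sgn m by auto
  have yO: "y i - vO = t i *\<^sub>R (vQ - vO)" and yQ: "vQ - y i = (1 - t i) *\<^sub>R (vQ - vO)" for i
    by (simp_all add: y_def algebra_simps)
  have t: "0 < t i" "t i < 1" if "lin (h i) vO < 0" "lin (h i) vQ > 0" for i
    using that by (auto simp: t_def divide_simps)
  have nO: "norm (vO - y i) = t i * norm (vQ - vO)" and nQ: "norm (vQ - y i) = (1 - t i) * norm (vQ - vO)"
    if "lin (h i) vO < 0" "lin (h i) vQ > 0" for i
    using t[OF that] by (simp_all add: norm_minus_commute[of vO] yO yQ)
  have "R\<^sup>2 * (t 3 * (1 - t j)) \<le> t j * (1 - t 3)"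
  proof -
    define D where "D i = lin (h i) vQ - lin (h i) vO" for i
    have D: "D 3 > 0" "D j > 0" using sgn by (simp_all add: D_def)
    have t': "t i = - lin (h i) vO / D i" for i by (simp add: t_def D_def)
    have s: "1 - t i = lin (h i) vQ / D i" if "D i > 0" for i
      using that by (simp add: t' field_simps) (simp add: D_def)
    have "R\<^sup>2 * (- lin (h 3) vO * lin (h j) vQ) \<le> - lin (h j) vO * lin (h 3) vQ"
      using sgn R by (simp add: field_simps)
    then have "R\<^sup>2 * (- lin (h 3) vO * lin (h j) vQ) / (D 3 * D j)
        \<le> - lin (h j) vO * lin (h 3) vQ / (D 3 * D j)"
      by (rule divide_right_mono) (use D in simp)
    then show ?thesis unfolding s[OF D(1)] s[OF D(2)] unfolding t' by (simp add: mult.commute)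
  qed
  then have "R\<^sup>2 * (t 3 * (1 - t j)) * (norm (vQ - vO))\<^sup>2 \<le> t j * (1 - t 3) * (norm (vQ - vO))\<^sup>2"
    by (rule mult_right_mono) simp
  then have "R\<^sup>2 * (norm (vO - y 3) * norm (vQ - y j)) \<le> norm (vO - y j) * norm (y 3 - vQ)"
    unfolding norm_minus_commute[of "y 3"] nO[OF sgn(1,2)] nQ[OF sgn(1,2)] nO[OF sgn(3,4)] nQ[OF sgn(3,4)]
    by (simp add: power2_eq_square mult_ac)
  moreover have "vO \<noteq> y 3" "vQ \<noteq> y j"
    using nO[of 3] nQ[of j] t[of 3] t[of j] sgn ne by auto
  ultimately show "arrangement_span (map (to_line \<circ> h) [0..<m]) \<ge> R"
    using arrangement_span_ge[OF L O Q Y] R(1) by blast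
qed

section \<open>The model arrangement\<close>

text \<open>In round \<open>i\<close> the pairs \<open>(a, b)\<close> of the lines \<open>6 + 3 i\<close>, \<open>7 + 3 i\<close>, \<open>8 + 3 i\<close>, \<open>9 + 3 i\<close> are
  \<open>(d\<^sup>2, d)\<close>, \<open>(d\<^sup>2 / 2, 2)\<close>, \<open>(d\<^sup>2 / 3, d\<^sup>2 / 6)\<close> and \<open>(e\<^sup>2, e)\<close> with \<open>d = shrink i\<close> and
  \<open>e = d\<^sup>2 / 12\<close>; the constants leave room in all six comparisons.\<close>

primrec shrink :: "nat \<Rightarrow> real" where
  "shrink 0 = 1 / 16"
| "shrink (Suc i) = (shrink i)\<^sup>2 / 12"

definition coeff0 :: "nat \<Rightarrow> real" where
  "coeff0 j = (if j = 3 then 1 else if j = 4 then -1/4 else if j = 5 then 1/2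
     else if (j - 6) mod 3 = 0 then (shrink ((j - 6) div 3))\<^sup>2
     else if (j - 6) mod 3 = 1 then (shrink ((j - 6) div 3))\<^sup>2 / 2
     else (shrink ((j - 6) div 3))\<^sup>2 / 3)"

definition coeff1 :: "nat \<Rightarrow> real" where
  "coeff1 j = (if j = 3 then 1 else if j = 4 then 1/2 else if j = 5 then -1/4
     else if (j - 6) mod 3 = 0 then shrink ((j - 6) div 3)
     else if (j - 6) mod 3 = 1 then 2
     else (shrink ((j - 6) div 3))\<^sup>2 / 6)"

definition frame_value :: "nat \<Rightarrow> real \<Rightarrow> real \<Rightarrow> real \<Rightarrow> real" where
  "frame_value j u v w = (if j = 0 then u else if j = 1 then v else if j = 2 then w
     else coeff0 j * u + coeff1 j * v - w)"

text \<open>The last case is \<open>coeff0 j * y + coeff1 j * x - (1 - x - 2 * y)\<close>,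
  expanded.\<close>

definition model :: "nat \<Rightarrow> (real^2) \<times> real" where
  "model j = (if j = 0 then (vector [0, 1], 0) else if j = 1 then (vector [1, 0], 0)
     else if j = 2 then (vector [-1, -2], -1) else (vector [coeff1 j + 1, coeff0 j + 2], 1))"

text \<open>Homogeneous coordinates \<open>(u : v : w)\<close> with respect to the triangle; \<open>2 u + v + w = 0\<close> is the
  line at infinity.\<close>

lemma lin_model:
  assumes "2 * u + v + w \<noteq> 0"
  shows "lin (model j) (vector [v / (2 * u + v + w), u / (2 * u + v + w)])
    = frame_value j u v w / (2 * u + v + w)"
proof -
  define g where "g = 2 * u + v + w"
  have "w = g - 2 * u - v" "g \<noteq> 0" using assms by (simp_all add: g_def)
  then show ?thesis
    unfolding g_def[symmetric]
    by (simp add: lin_def model_def frame_value_def inner_vec_def sum_2 field_simps)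
qed

lemma frame_value_add:
  "frame_value j (u + e * u') (v + e * v') (w + e * w') = frame_value j u v w + e * frame_value j u' v' w'"
  by (simp add: frame_value_def algebra_simps)

text \<open>Sign vectors may be read off at a point where some of the lines vanish, if the displacement
  \<open>(u', v', w')\<close> then breaks the ties.\<close>

lemma ex_sat_model:
  assumes g: "2 * u + v + w > 0"
    and val: "\<And>j. j < m \<Longrightarrow> s j \<noteq> 0 \<Longrightarrow> s j * frame_value j u v w > 0 \<or>
      frame_value j u v w = 0 \<and> s j * frame_value j u' v' w' > 0"
  shows "\<exists>p. sat model m s p"
proof -
  \<comment> \<open>A value that is positive, or zero with positive slope, is positive for all small
    \<open>e > 0\<close>. Finitely many lines then share one such \<open>e\<close>.\<close>
  have ev: "\<forall>\<^sub>F e in at_right (0::real). x + e * y > 0" if "x > 0 \<or> x = 0 \<and> y > 0" for x y :: real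
    using that
  proof
    assume "x > 0"
    have "((\<lambda>e. x + e * y) \<longlongrightarrow> x + 0 * y) (at_right 0)" by (intro tendsto_intros)
    then show ?thesis using \<open>x > 0\<close> order_tendstoD(1) by fastforce
  next
    assume "x = 0 \<and> y > 0"
    then show ?thesis using eventually_at_right_less[of "0::real"] by (auto elim!: eventually_mono)
  qed
  have "\<forall>\<^sub>F e in at_right 0. \<forall>j\<in>{j. j < m \<and> s j \<noteq> 0}.
      s j * frame_value j u v w + e * (s j * frame_value j u' v' w') > 0"
    using val by (intro eventually_ball_finite ballI ev) auto
  moreover have "\<forall>\<^sub>F e in at_right 0. (2 * u + v + w) + e * (2 * u' + v' + w') > 0"
    using g by (intro ev) auto
  ultimately have "\<forall>\<^sub>F e in at_right (0::real).
      (\<forall>j\<in>{j. j < m \<and> s j \<noteq> 0}. s j * frame_value j u v w + e * (s j * frame_value j u' v' w') > 0) \<and>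
      (2 * u + v + w) + e * (2 * u' + v' + w') > 0"
    by (rule eventually_conj)
  then obtain e where e: "\<And>j. j < m \<Longrightarrow> s j \<noteq> 0 \<Longrightarrow>
      s j * frame_value j u v w + e * (s j * frame_value j u' v' w') > 0"
    "(2 * u + v + w) + e * (2 * u' + v' + w') > 0"
    using eventually_happens'[OF trivial_limit_at_right_real] by blast
  define g' where "g' = 2 * (u + e * u') + (v + e * v') + (w + e * w')"
  have g': "g' > 0" using e(2) by (simp add: g'_def algebra_simps)
  have "sat model m s (vector [(v + e * v') / g', (u + e * u') / g'])"
    unfolding sat_def
  proof (intro allI impI)
    fix j assume j: "j < m" "s j \<noteq> 0"
    have "s j * lin (model j) (vector [(v + e * v') / g', (u + e * u') / g'])
        = (s j * frame_value j u v w + e * (s j * frame_value j u' v' w')) / g'"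
      using g' unfolding g'_def
      by (subst lin_model) (simp_all add: frame_value_add algebra_simps add_divide_distrib)
    then show "s j * lin (model j) (vector [(v + e * v') / g', (u + e * u') / g']) > 0"
      using e(1)[OF j] g' by simp
  qed
  then show ?thesis ..
qed

lemma shrink_pos: "0 < shrink i"
  by (induction i) simp_all

lemma shrink_le: "shrink i \<le> 1 / 16"
proof (induction i)
  case (Suc i)
  have "shrink i * shrink i \<le> 1 / 16 * (1 / 16)"
    using Suc shrink_pos[of i] by (intro mult_mono) auto
  then show ?case by (simp add: power2_eq_square)
qed simp

lemma coeff_simps:
  "coeff0 (6 + 3 * i) = (shrink i)\<^sup>2" "coeff1 (6 + 3 * i) = shrink i"
  "coeff0 (7 + 3 * i) = (shrink i)\<^sup>2 / 2" "coeff1 (7 + 3 * i) = 2"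
  "coeff0 (8 + 3 * i) = (shrink i)\<^sup>2 / 3" "coeff1 (8 + 3 * i) = (shrink i)\<^sup>2 / 6"
proof -
  have "Suc (3 * i) div 3 = i" "Suc (Suc (3 * i)) div 3 = i"
    "Suc (3 * i) mod 3 = 1" "Suc (Suc (3 * i)) mod 3 = 2"
    by arith+
  then show "coeff0 (6 + 3 * i) = (shrink i)\<^sup>2" "coeff1 (6 + 3 * i) = shrink i"
    "coeff0 (7 + 3 * i) = (shrink i)\<^sup>2 / 2" "coeff1 (7 + 3 * i) = 2"
    "coeff0 (8 + 3 * i) = (shrink i)\<^sup>2 / 3" "coeff1 (8 + 3 * i) = (shrink i)\<^sup>2 / 6"
    by (simp_all add: coeff0_def coeff1_def)
qed

lemma coeff_simps_Suc:
  "coeff0 (9 + 3 * i) = ((shrink i)\<^sup>2 / 12)\<^sup>2" "coeff1 (9 + 3 * i) = (shrink i)\<^sup>2 / 12"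
  using coeff_simps(1,2)[of "Suc i"] by simp_all

lemma index_cases:
  assumes "6 \<le> (j::nat)"
  obtains i where "j = 6 + 3 * i" | i where "j = 7 + 3 * i" | i where "j = 8 + 3 * i"
proof -
  have "j = 6 + 3 * ((j - 6) div 3) \<or> j = 7 + 3 * ((j - 6) div 3) \<or> j = 8 + 3 * ((j - 6) div 3)"
    using assms by presburger
  then show thesis using that by blast
qed

lemma shrink_sq_less: "((shrink i)\<^sup>2 / 12)\<^sup>2 < (shrink i)\<^sup>2 / 3"
proof -
  have "(shrink i)\<^sup>2 \<le> 1\<^sup>2" using shrink_le[of i] shrink_pos[of i] by (intro power_mono) auto
  then have "(shrink i)\<^sup>2 * (shrink i)\<^sup>2 \<le> (shrink i)\<^sup>2 * 1" by (intro mult_left_mono) auto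
  moreover have "(shrink i)\<^sup>2 > 0" using shrink_pos[of i] by simp
  ultimately show ?thesis by (simp add: power2_eq_square)
qed

lemma coeff0_Suc_less:
  assumes "6 \<le> j"
  shows "coeff0 (Suc j) < coeff0 j"
proof -
  have pos: "(shrink i)\<^sup>2 > 0" for i using shrink_pos[of i] by simp
  from assms show ?thesis
  proof (cases j rule: index_cases)
    case (1 i)
    then have "Suc j = 7 + 3 * i" by simp
    then show ?thesis unfolding \<open>Suc j = 7 + 3 * i\<close> unfolding 1 coeff_simps using pos[of i] by simp
  next
    case (2 i)
    then have "Suc j = 8 + 3 * i" by simp
    then show ?thesis unfolding \<open>Suc j = 8 + 3 * i\<close> unfolding 2 coeff_simps using pos[of i] by simp
  next
    case (3 i)
    then have eq: "Suc j = 9 + 3 * i" by simp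
    show ?thesis unfolding eq unfolding 3 coeff_simps coeff_simps_Suc by (rule shrink_sq_less)
  qed
qed

lemma coeff_pos:
  assumes "6 \<le> j"
  shows "coeff0 j > 0" "coeff1 j > 0"
  using assms by (cases j rule: index_cases; simp add: coeff_simps shrink_pos less_imp_neq[symmetric])+

lemma coeff_pos_or:
  assumes "3 \<le> j"
  shows "j \<noteq> 4 \<Longrightarrow> coeff0 j > 0" "j \<noteq> 5 \<Longrightarrow> coeff1 j > 0" "coeff0 4 < 0" "coeff1 5 < 0"
proof -
  have "j = 3 \<or> j = 4 \<or> j = 5 \<or> 6 \<le> j" using assms by arith
  then show "j \<noteq> 4 \<Longrightarrow> coeff0 j > 0" "j \<noteq> 5 \<Longrightarrow> coeff1 j > 0"
    using coeff_pos[of j] by (auto simp: coeff0_def[of 3] coeff0_def[of 5] coeff1_def[of 3] coeff1_def[of 4])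
qed (simp_all add: coeff0_def coeff1_def)

lemma coeff0_inj:
  assumes "3 \<le> i" "i < j"
  shows "coeff0 i \<noteq> coeff0 j"
proof -
  have less: "coeff0 y < coeff0 x" if "6 \<le> x" "x < y" for x y
    using that(2,1)
  proof (induction y rule: less_Suc_induct)
    case (1 i)
    then show ?case using coeff0_Suc_less by simp
  next
    case (2 i j k)
    then show ?case by (meson le_trans less_imp_le less_trans)
  qed
  have "coeff0 6 = 1 / 256" using coeff_simps(1)[of 0] by (simp add: power2_eq_square)
  then have small: "0 < coeff0 x" "coeff0 x \<le> 1 / 256" if "6 \<le> x" for x
    using coeff_pos[OF that] less[of 6 x] that by (cases "x = 6"; simp)+
  have special: "coeff0 3 = 1" "coeff0 4 = - 1 / 4" "coeff0 5 = 1 / 2" by (simp_all add: coeff0_def)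
  have "i \<in> {3, 4, 5} \<or> 6 \<le> i" "j \<in> {4, 5} \<or> 6 \<le> j" using assms by auto
  then show ?thesis
    using small[of i] small[of j] less[of i j] assms by (elim disjE) (auto simp: special)
qed

section \<open>Realizing the patterns in the model\<close>

lemma frame_value_simps:
  "frame_value 0 u v w = u" "frame_value (Suc 0) u v w = v" "frame_value 2 u v w = w"
  "3 \<le> j \<Longrightarrow> frame_value j u v w = coeff0 j * u + coeff1 j * v - w"
  by (auto simp: frame_value_def)

lemma index_cases3:
  obtains "j = (0::nat)" | "j = Suc 0" | "j = 2" | "3 \<le> j"
  by linarith

text \<open>The base point is the vertex itself, a coordinate point of the frame. Putting
  \<open>s\<close> and \<open>t\<close> into its two vanishing coordinates leads into the required
  quadrant.\<close>

lemma ex_sat_vertex: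
  assumes "(i, l, w) \<in> set vertex_specs" and s: "s \<in> {1, -1}" and t: "t \<in> {1, -1}"
  shows "\<exists>p. sat model m (w(i := s, l := t)) p"
proof -
  let ?P = "\<lambda>u v w' u' v' w''. \<forall>j. (w(i := s, l := t)) j * frame_value j u v w' > 0 \<or>
      frame_value j u v w' = 0 \<and> (w(i := s, l := t)) j * frame_value j u' v' w'' > 0"
  have sq: "s * s = 1" "t * t = 1" using s t by auto
  consider "i = 0" "l = 1" "w = (\<lambda>j. if j = 2 then 1 else -1)"
    | "i = 0" "l = 2" "w = (\<lambda>j. if j = 5 then -1 else 1)"
    | "i = 1" "l = 2" "w = (\<lambda>j. if j = 4 then -1 else 1)"
    using assms(1) by (auto simp: vertex_specs_def)
  then show ?thesis
  proof cases
    case 1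
    have "?P 0 0 1 s t 0"
    proof
      fix j show "(w(i := s, l := t)) j * frame_value j 0 0 1 > 0 \<or>
        frame_value j 0 0 1 = 0 \<and> (w(i := s, l := t)) j * frame_value j s t 0 > 0"
        by (cases j rule: index_cases3) (simp_all add: 1 frame_value_simps sq)
    qed
    then show ?thesis by (intro ex_sat_model[of 0 0 1 m _ s t 0]) auto
  next
    case 2
    have "?P 0 1 0 s 0 t"
    proof
      fix j show "(w(i := s, l := t)) j * frame_value j 0 1 0 > 0 \<or>
        frame_value j 0 1 0 = 0 \<and> (w(i := s, l := t)) j * frame_value j s 0 t > 0"
        using coeff_pos_or[of j]
        by (cases j rule: index_cases3) (simp_all add: 2 frame_value_simps sq)
    qed
    then show ?thesis by (intro ex_sat_model[of 0 1 0 m _ s 0 t]) auto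
  next
    case 3
    have "?P 1 0 0 0 s t"
    proof
      fix j show "(w(i := s, l := t)) j * frame_value j 1 0 0 > 0 \<or>
        frame_value j 1 0 0 = 0 \<and> (w(i := s, l := t)) j * frame_value j 0 s t > 0"
        using coeff_pos_or[of j]
        by (cases j rule: index_cases3) (simp_all add: 3 frame_value_simps sq)
    qed
    then show ?thesis by (intro ex_sat_model[of 1 0 0 m _ 0 s t]) auto
  qed
qed

text \<open>At a base point on line \<open>i\<close> the signs for \<open>l\<close>,
  \<open>A\<close> and \<open>B\<close> are already strict; the displacement scaled by
  \<open>s\<close> only chooses the side of line \<open>i\<close>.\<close>

lemma ex_sat_cmp_pattern:
  assumes i: "i < 3" "l < 3" "i \<noteq> l" and A: "3 \<le> A" and B: "3 \<le> B" "A \<noteq> B"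
    and s: "s \<in> {1, -1}" and base: "frame_value i u v w = 0" "t * frame_value l u v w > 0"
      "frame_value A u v w < 0" "frame_value B u v w > 0"
    and dir: "frame_value i u' v' w' = 1" and g: "2 * u + v + w > 0"
  shows "\<exists>p. sat model m ((cmp_pattern l t A B)(i := s)) p"
proof (rule ex_sat_model[OF g, of _ _ "s * u'" "s * v'" "s * w'"])
  fix j assume j: "((cmp_pattern l t A B)(i := s)) j \<noteq> 0"
  have "frame_value i (s * u') (s * v') (s * w') = s"
    using frame_value_add[of i 0 s u' 0 v' 0 w'] dir i(1) by (simp add: frame_value_def)
  moreover have "s * s = 1" using s by auto
  moreover have "j \<in> {i, l, A, B}" using j by (auto simp: cmp_pattern_def split: if_splits)
  ultimately show "((cmp_pattern l t A B)(i := s)) j * frame_value j u v w > 0 \<or>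
      frame_value j u v w = 0 \<and>
      ((cmp_pattern l t A B)(i := s)) j * frame_value j (s * u') (s * v') (s * w') > 0"
    using i A B base by (auto simp: cmp_pattern_def)
qed

lemma ex_between:
  fixes x y :: real
  assumes "x < y" "0 < x + y"
  obtains r where "r > 0" "x * r < 1" "1 < y * r"
proof
  \<comment> \<open>The reciprocal of the mean of \<open>x\<close> and \<open>y\<close>.\<close>
  show "2 / (x + y) > 0" "x * (2 / (x + y)) < 1" "1 < y * (2 / (x + y))"
    using assms by (simp_all add: field_simps)
qed

lemma ex_sat_cmp_coeff1:
  assumes "3 \<le> A" "3 \<le> B" "coeff1 A < coeff1 B" "0 < coeff1 A + coeff1 B" "s \<in> {1, -1}"
  shows "\<exists>p. sat model m ((cmp_pattern 2 1 A B)(0 := s)) p"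
proof -
  obtain r where "r > 0" "coeff1 A * r < 1" "1 < coeff1 B * r"
    using ex_between assms(3,4) .
  then show ?thesis using assms
    by (intro ex_sat_cmp_pattern[where u = 0 and v = r and w = 1 and u' = 1 and v' = 0 and w' = 0])
       (auto simp: frame_value_simps)
qed

lemma ex_sat_cmp_coeff0:
  assumes "3 \<le> A" "3 \<le> B" "coeff0 A < coeff0 B" "0 < coeff0 A + coeff0 B" "s \<in> {1, -1}"
  shows "\<exists>p. sat model m ((cmp_pattern 2 1 A B)(1 := s)) p"
proof -
  obtain r where "r > 0" "coeff0 A * r < 1" "1 < coeff0 B * r"
    using ex_between assms(3,4) .
  then show ?thesis using assms
    by (intro ex_sat_cmp_pattern[where u = r and v = 0 and w = 1 and u' = 0 and v' = 1 and w' = 0])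
       (auto simp: frame_value_simps)
qed

lemma ex_sat_cmp_slope:
  assumes "3 \<le> A" "3 \<le> B" "0 < coeff0 A" "0 < coeff0 B" "coeff0 B \<le> 2 * coeff1 B"
    "coeff1 B * coeff0 A < coeff1 A * coeff0 B" "s \<in> {1, -1}"
  shows "\<exists>p. sat model m ((cmp_pattern 1 (-1) A B)(2 := s)) p"
proof -
  have "coeff1 B / coeff0 B < coeff1 A / coeff0 A" using assms by (simp add: field_simps)
  then obtain r where r: "coeff1 B / coeff0 B < r" "r < coeff1 A / coeff0 A"
    using dense by blast
  have "1 / 2 \<le> coeff1 B / coeff0 B" using assms by (simp add: field_simps)
  then have "2 * r - 1 > 0" using r(1) by linarith
  moreover have "coeff1 B < coeff0 B * r" "coeff0 A * r < coeff1 A"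
    using r assms by (simp_all add: field_simps)
  moreover have "A \<noteq> B" using r by auto
  ultimately show ?thesis using assms
    by (intro ex_sat_cmp_pattern[where u = r and v = "-1" and w = 0 and u' = 0 and v' = 0 and w' = 1])
       (auto simp: frame_value_simps)
qed

lemma coeff_values:
  "coeff0 3 = 1" "coeff0 4 = - 1 / 4" "coeff0 5 = 1 / 2" "coeff0 6 = 1 / 256"
  "coeff1 3 = 1" "coeff1 4 = 1 / 2" "coeff1 5 = - 1 / 4" "coeff1 6 = 1 / 16"
  by (simp_all add: coeff0_def coeff1_def power2_eq_square)

lemma ex_sat_seed: "\<exists>p. sat model m seed p"
proof (rule ex_sat_model[of 6 6 1 _ _ 0 0 0])
  fix j assume "seed j \<noteq> 0"
  then have "j \<in> {0, 1, 2, 4, 5, 6}" by (auto simp: seed_def split: if_splits)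
  then show "seed j * frame_value j 6 6 1 > 0 \<or>
      frame_value j 6 6 1 = 0 \<and> seed j * frame_value j 0 0 0 > 0"
    by (auto simp: seed_def frame_value_simps coeff_values)
qed simp

lemma ex_sat_step_cmps:
  assumes "(i, l, t, A, B) \<in> set (step_cmps n)" and s: "s \<in> {1, -1}"
  shows "\<exists>p. sat model m ((cmp_pattern l t A B)(i := s)) p"
proof -
  define d where "d = shrink n"
  have d: "d > 0" "d \<le> 1 / 16" using shrink_pos shrink_le by (simp_all add: d_def)
  then have d2: "d\<^sup>2 > 0" "d\<^sup>2 \<le> 1" by (simp_all add: power_le_one)
  note coeffs = coeff_simps[of n, folded d_def] coeff_simps_Suc[of n, folded d_def]
    coeff_values(1,5)
  consider "(i, l, t, A, B) = (1, 2, 1, 7 + 3 * n, 6 + 3 * n)"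
    | "(i, l, t, A, B) = (0, 2, 1, 3, 7 + 3 * n)"
    | "(i, l, t, A, B) = (1, 2, 1, 8 + 3 * n, 6 + 3 * n)"
    | "(i, l, t, A, B) = (2, 1, -1, 3, 8 + 3 * n)"
    | "(i, l, t, A, B) = (0, 2, 1, 9 + 3 * n, 8 + 3 * n)"
    | "(i, l, t, A, B) = (2, 1, -1, 9 + 3 * n, 7 + 3 * n)"
    using assms(1) unfolding step_cmps_def by auto
  then show ?thesis
  proof cases
    case 1
    then have "\<exists>p. sat model m ((cmp_pattern 2 1 (7 + 3 * n) (6 + 3 * n))(1 := s)) p"
      using s d2 by (intro ex_sat_cmp_coeff0) (simp_all add: coeffs)
    then show ?thesis using 1 by simp
  next
    case 2
    then have "\<exists>p. sat model m ((cmp_pattern 2 1 3 (7 + 3 * n))(0 := s)) p"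
      using s by (intro ex_sat_cmp_coeff1) (simp_all add: coeffs)
    then show ?thesis using 2 by simp
  next
    case 3
    then have "\<exists>p. sat model m ((cmp_pattern 2 1 (8 + 3 * n) (6 + 3 * n))(1 := s)) p"
      using s d2 by (intro ex_sat_cmp_coeff0) (simp_all add: coeffs)
    then show ?thesis using 3 by simp
  next
    case 4
    then have "\<exists>p. sat model m ((cmp_pattern 1 (-1) 3 (8 + 3 * n))(2 := s)) p"
      using s d2 by (intro ex_sat_cmp_slope) (simp_all add: coeffs)
    then show ?thesis using 4 by simp
  next
    case 5
    then have "\<exists>p. sat model m ((cmp_pattern 2 1 (9 + 3 * n) (8 + 3 * n))(0 := s)) p"
      using s d2 by (intro ex_sat_cmp_coeff1) (simp_all add: coeffs)
    then show ?thesis using 5 by simp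
  next
    case 6
    then have "\<exists>p. sat model m ((cmp_pattern 1 (-1) (9 + 3 * n) (7 + 3 * n))(2 := s)) p"
      using s d2 by (intro ex_sat_cmp_slope) (simp_all add: coeffs power2_eq_square[of "d\<^sup>2 / 12"])
    then show ?thesis using 6 by simp
  qed
qed

lemma ex_sat_patterns:
  assumes "w \<in> set (patterns n)"
  shows "\<exists>p. sat model m w p"
proof -
  have base: "\<exists>p. sat model m ((cmp_pattern l t A B)(i := s)) p"
    if "(i, l, t, A, B) \<in> {(0, 2, 1, 4, 3), (1, 2, 1, 5, 3), (2, 1, -1, 6, 3)}" "s \<in> {1, -1}"
    for i l t A B s
  proof -
    have "\<exists>p. sat model m ((cmp_pattern 2 1 4 3)(0 := s)) p"
      using that(2) by (intro ex_sat_cmp_coeff1) (simp_all add: coeff_values)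
    moreover have "\<exists>p. sat model m ((cmp_pattern 2 1 5 3)(1 := s)) p"
      using that(2) by (intro ex_sat_cmp_coeff0) (simp_all add: coeff_values)
    moreover have "\<exists>p. sat model m ((cmp_pattern 1 (-1) 6 3)(2 := s)) p"
      using that(2) by (intro ex_sat_cmp_slope) (simp_all add: coeff_values)
    moreover have "(i, l, t, A, B) = (0, 2, 1, 4, 3) \<or> (i, l, t, A, B) = (1, 2, 1, 5, 3) \<or>
        (i, l, t, A, B) = (2, 1, -1, 6, 3)"
      using that(1) by simp
    ultimately show ?thesis by (elim disjE) simp_all
  qed
  have cmp: "\<exists>p. sat model m ((cmp_pattern l t A B)(i := s)) p"
    if "(i, l, t, A, B) \<in> set (cmps n)" "s \<in> {1, -1}" for i l t A B s
  proof -
    have "(i, l, t, A, B) \<in> {(0, 2, 1, 4, 3), (1, 2, 1, 5, 3), (2, 1, -1, 6, 3)} \<or>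
        (\<exists>k. (i, l, t, A, B) \<in> set (step_cmps k))"
      using that(1) unfolding cmps_def by auto
    then show ?thesis
    proof
      assume "\<exists>k. (i, l, t, A, B) \<in> set (step_cmps k)"
      then show ?thesis using ex_sat_step_cmps that(2) by blast
    qed (rule base, use that(2) in simp_all)
  qed
  consider "w = seed"
    | i l w' s t where "w = w'(i := s, l := t)" "(i, l, w') \<in> set vertex_specs" "s \<in> {1, -1}" "t \<in> {1, -1}"
    | i l t A B s where "w = (cmp_pattern l t A B)(i := s)" "(i, l, t, A, B) \<in> set (cmps n)" "s \<in> {1, -1}"
    using assms by (rule patterns_cases)
  then show ?thesis
  proof cases
    case 1
    then show ?thesis using ex_sat_seed by simp
  next
    case 2
    then show ?thesis using ex_sat_vertex by simp
  next
    case 3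
    then show ?thesis using cmp by simp
  qed
qed

section \<open>Distinctness of the model lines and conclusion\<close>

lemma fst_model_nonzero: "fst (model j) \<noteq> 0"
proof -
  have "coeff1 j + 1 > 0" if "3 \<le> j"
    using coeff_pos_or(2)[OF that] by (cases "j = 5") (simp_all add: coeff_values)
  then show ?thesis
    by (cases j rule: index_cases3) (auto simp: model_def vec_eq_iff forall_2)
qed

lemma model_lines_distinct:
  assumes "i < j"
  shows "{x. lin (model i) x = 0} \<noteq> {x. lin (model j) x = 0}"
proof -
  have ne: "{x. lin (model i) x = 0} \<noteq> {x. lin (model j) x = 0}"
    if "2 * u + v + w \<noteq> 0" "frame_value j u v w = 0" "frame_value i u v w \<noteq> 0" for u v w
    using lin_model[OF that(1), of i] lin_model[OF that(1), of j] that by force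
  show ?thesis
  proof (cases "3 \<le> j")
    case True
    have c0: "coeff0 j \<noteq> 0" "coeff0 j \<noteq> -2"
      using coeff_pos_or(1)[OF True] by (cases "j = 4"; simp add: coeff_values)+
    have c1: "coeff1 j \<noteq> 0" "coeff1 j \<noteq> -1"
      using coeff_pos_or(2)[OF True] by (cases "j = 5"; simp add: coeff_values)+
    show ?thesis
    proof (cases "i = 1")
      case True
      show ?thesis
        by (rule ne[of 0 "1 / coeff1 j" 1])
          (use c1 \<open>3 \<le> j\<close> True in \<open>simp_all add: frame_value_simps field_simps\<close>)
    next
      case False
      have "3 \<le> i \<Longrightarrow> coeff0 i \<noteq> coeff0 j" using coeff0_inj assms by blast
      then show ?thesis
        by (intro ne[of "1 / coeff0 j" 0 1]; cases i rule: index_cases3)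
          (use c0 \<open>3 \<le> j\<close> False in \<open>simp_all add: frame_value_simps field_simps\<close>)
    qed
  next
    case False
    then consider "i = 0" "j = 1" | "i = 0" "j = 2" | "i = 1" "j = 2" using assms by linarith
    then show ?thesis
    proof cases
      case 3
      then show ?thesis by (intro ne[of 0 1 0]) (simp_all add: frame_value_simps)
    qed (intro ne[of 1 0 0]; simp add: frame_value_simps)+
  qed
qed

theorem theorem3p2:
  fixes k :: nat
  shows "\<exists>(m::nat) (S :: sign list set).
     m \<le> 12 * k + 37 \<and>
     S \<subseteq> {v. length v = m \<and> set v \<subseteq> {Neg, Pos}} \<and>
     card S \<le> 33 * k + 103 \<and>
     (\<exists>L. oriented_line_arrangement L \<and> length L = m \<and> S \<subseteq> combinatorial_description L) \<and>
     (\<forall>L. oriented_line_arrangement L \<and> length L = m \<and> S \<subseteq> combinatorial_description L \<longrightarrow>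
        card (intersection_points L) \<ge> 2 \<and> arrangement_span L \<ge> 2 ^ (2 ^ k))"
proof -
  \<comment> \<open>The cross ratio bounds only the square of the span, which costs one extra round.
    This gives \<open>m = 3 * k + 10\<close> and at most \<open>12 * k + 31\<close> sign
    vectors.\<close>
  define n m where "n = Suc k" and "m = 7 + 3 * n"
  have "\<exists>S. S \<subseteq> {v. length v = m \<and> set v \<subseteq> {Neg, Pos}} \<and> card S \<le> length (patterns n) \<and>
    (\<exists>L. oriented_line_arrangement L \<and> length L = m \<and> S \<subseteq> combinatorial_description L) \<and>
    (\<forall>h. S \<subseteq> combinatorial_description (map (to_line \<circ> h) [0..<m]) \<longrightarrow>
       (\<forall>w\<in>set (patterns n). \<exists>p. sat h m w p))"
    by (rule ex_sign_vectors[OF fst_model_nonzero model_lines_distinct ex_sat_patterns])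
  then obtain S where S: "S \<subseteq> {v. length v = m \<and> set v \<subseteq> {Neg, Pos}}"
      "card S \<le> length (patterns n)"
      "\<exists>L. oriented_line_arrangement L \<and> length L = m \<and> S \<subseteq> combinatorial_description L"
    and forced: "\<And>h. S \<subseteq> combinatorial_description (map (to_line \<circ> h) [0..<m]) \<Longrightarrow>
       \<forall>w\<in>set (patterns n). \<exists>p. sat h m w p"
    by blast
  have span: "card (intersection_points L) \<ge> 2 \<and> arrangement_span L \<ge> 2 ^ (2 ^ k)"
    if L: "oriented_line_arrangement L" "length L = m" "S \<subseteq> combinatorial_description L" for L
  proof -
    have "\<exists>l. L ! j = to_line l" if "j < m" for j
      using is_oriented_lineE[of "L ! j"] L that
      by (metis nth_mem oriented_line_arrangement_def)
    then obtain h where "\<And>j. j < m \<Longrightarrow> L ! j = to_line (h j)" by metis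
    then have h: "L = map (to_line \<circ> h) [0..<m]"
      using L(2) by (intro nth_equalityI) auto
    have "\<exists>p. sat h (7 + 3 * n) w p" if "w \<in> set (patterns n)" for w
      using forced[of h] L(3) that unfolding h m_def by blast
    then obtain vO vQ where v: "lin (h 0) vO = 0" "lin (h 1) vO = 0" "lin (h 1) vQ = 0" "lin (h 2) vQ = 0"
      "lin (h 3) vO < 0" "lin (h 3) vQ > 0" "lin (h (6 + 3 * n)) vO < 0" "lin (h (6 + 3 * n)) vQ > 0"
      "2 ^ 2 ^ n * (lin (h 3) vO / lin (h 3) vQ) \<ge> lin (h (6 + 3 * n)) vO / lin (h (6 + 3 * n)) vQ"
      by (rule forced_cross_ratio)
    have "(2 ^ 2 ^ n :: real) = (2 ^ 2 ^ k)\<^sup>2"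
      by (simp add: n_def power_mult[symmetric] mult.commute)
    note cr = v(9)[unfolded this]
    have "7 \<le> m" "3 \<le> 6 + 3 * n" "6 + 3 * n < m" by (simp_all add: m_def)
    note span = arrangement_span_ge_cross_ratio[OF L(1)[unfolded h] this v(1-8) _ cr]
    show ?thesis unfolding h using span by simp
  qed
  have "m \<le> 12 * k + 37" "card S \<le> 33 * k + 103"
    using S(2) by (simp_all add: m_def n_def length_patterns)
  then show ?thesis
    using S(1,3) span by blast
qed

end
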